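(* Let $T$ be a Stone KAN-algebra. Then $\langle M(T),\cup,\cap,\approx,\circledast,c_M,0_M,1_M\rangle$ is a centered Stone KAN-algebra (with $\cup$ as join, $\cap$ as meet, $\approx$ in the role of $\sim$, $\circledast$ in the role of $\neg$, and center $c_M$).
   Context: A Kleene algebra is an algebra $\langle T,\vee,\wedge,\sim,0,1\rangle$ whose reduct $\langle T,\vee,\wedge,0,1\rangle$ is a bounded distributive lattice and such that $\sim\sim x=x$, $\sim(x\vee y)=\sim x\wedge\sim y$ and $x\wedge\sim x\le y\vee\sim y$ for all $x,y$. A KAN-algebra is an algebra $\langle T,\vee,\wedge,\sim,\neg,0,1\rangle$ of type $(2,2,1,1,0,0)$ whose $\neg$-free reduct is a Kleene algebra and which satisfies: (N1) $\neg(x\wedge\neg(x\wedge y))=\neg(x\wedge\neg y)$; (N2) $\neg(x\vee y)=\neg x\wedge\neg y$; (N3) $x\wedge\sim x=x\wedge\neg x$; (N4) $\sim x\le\neg x$; (N5) $\neg(x\wedge y)=\neg((\sim\neg x)\wedge y)$. A centered KAN-algebra is an algebra $\langle T,\vee,\wedge,\sim,\neg,c,0,1\rangle$ where $\langle T,\vee,\wedge,\sim,\neg,0,1\rangle$ is a KAN-algebra and the constant $c$ (the center) satisfies $\sim c=c$. A Stone KAN-algebra is a KAN-algebra satisfying $\neg x\vee\neg\neg x=1$ for all $x$; a centered Stone KAN-algebra is a centered KAN-algebra satisfying this same equation. Notation: $\lozenge x:=\sim\neg x$, $\square x:=\neg\sim x$, $T^{\lozenge}:=\{x\in T:\lozenge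 x=x\}$, $T^{\square}:=\{x\in T:\square x=x\}$. For a KAN-algebra $T$, $M(T):=\{(x,y)\in T^{\lozenge}\times T^{\square}: x\le y\}$, with the operations (under which $M(T)$ is closed) $(a,b)\cup(d,e):=(a\vee d,\square(b\vee e))$, $(a,b)\cap(d,e):=(\lozenge(a\wedge d),b\wedge e)$, $\approx(a,b):=(\sim b,\sim a)$, $\circledast(a,b):=(\lozenge\neg a,\sim a)$, $0_M:=(0,0)$, $1_M:=(1,1)$, $c_M:=(0,1)$. *)

theory Defs
  imports "HOL-Algebra.Congruence"
begin

record 'a kan_struct = "'a partial_object" +
  join :: "'a \<Rightarrow> 'a \<Rightarrow> 'a" (infixl "\<squnion>\<index>" 65)
  meet :: "'a \<Rightarrow> 'a \<Rightarrow> 'a" (infixl "\<sqinter>\<index>" 70)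
  tilde :: "'a \<Rightarrow> 'a" ("\<sim>\<index> _" [80] 80)
  neg :: "'a \<Rightarrow> 'a" ("\<^bold>\<not>\<index> _" [80] 80)
  zero :: 'a ("\<zero>\<index>")
  one :: 'a ("\<one>\<index>")

record 'a centered_kan_struct = "'a kan_struct" +
  center :: 'a

definition le :: "('a, 'm) kan_struct_scheme \<Rightarrow> 'a \<Rightarrow> 'a \<Rightarrow> bool"
    (infix "\<sqsubseteq>\<index>" 50) where
  "x \<sqsubseteq>\<^bsub>T\<^esub> y \<longleftrightarrow> x \<sqinter>\<^bsub>T\<^esub> y = x"

text \<open>The lattice of \<open>HOL-Algebra\<close> is an order with derived operations; here the operations
  are part of the signature.\<close>

locale bounded_distributive_lattice =
  fixes T (structure)
  assumes join_closed: "\<lbrakk>x \<in> carrier T; y \<in> carrier T\<rbrakk> \<Longrightarrow> x \<squnion> y \<in> carrier T"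
    and meet_closed: "\<lbrakk>x \<in> carrier T; y \<in> carrier T\<rbrakk> \<Longrightarrow> x \<sqinter> y \<in> carrier T"
    and zero_closed: "\<zero> \<in> carrier T"
    and one_closed: "\<one> \<in> carrier T"
    and join_assoc: "\<lbrakk>x \<in> carrier T; y \<in> carrier T; z \<in> carrier T\<rbrakk>
      \<Longrightarrow> (x \<squnion> y) \<squnion> z = x \<squnion> (y \<squnion> z)"
    and meet_assoc: "\<lbrakk>x \<in> carrier T; y \<in> carrier T; z \<in> carrier T\<rbrakk>
      \<Longrightarrow> (x \<sqinter> y) \<sqinter> z = x \<sqinter> (y \<sqinter> z)"
    and join_comm: "\<lbrakk>x \<in> carrier T; y \<in> carrier T\<rbrakk> \<Longrightarrow> x \<squnion> y = y \<squnion> x"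
    and meet_comm: "\<lbrakk>x \<in> carrier T; y \<in> carrier T\<rbrakk> \<Longrightarrow> x \<sqinter> y = y \<sqinter> x"
    and join_absorb: "\<lbrakk>x \<in> carrier T; y \<in> carrier T\<rbrakk> \<Longrightarrow> x \<squnion> (x \<sqinter> y) = x"
    and meet_absorb: "\<lbrakk>x \<in> carrier T; y \<in> carrier T\<rbrakk> \<Longrightarrow> x \<sqinter> (x \<squnion> y) = x"
    and meet_join_distrib: "\<lbrakk>x \<in> carrier T; y \<in> carrier T; z \<in> carrier T\<rbrakk>
      \<Longrightarrow> x \<sqinter> (y \<squnion> z) = (x \<sqinter> y) \<squnion> (x \<sqinter> z)"
    and zero_least: "x \<in> carrier T \<Longrightarrow> \<zero> \<sqsubseteq> x"
    and one_greatest: "x \<in> carrier T \<Longrightarrow> x \<sqsubseteq> \<one>"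

locale kleene_algebra = bounded_distributive_lattice +
  assumes tilde_closed: "x \<in> carrier T \<Longrightarrow> \<sim> x \<in> carrier T"
    and tilde_tilde: "x \<in> carrier T \<Longrightarrow> \<sim> \<sim> x = x"
    and tilde_join: "\<lbrakk>x \<in> carrier T; y \<in> carrier T\<rbrakk> \<Longrightarrow> \<sim> (x \<squnion> y) = \<sim> x \<sqinter> \<sim> y"
    and kleene: "\<lbrakk>x \<in> carrier T; y \<in> carrier T\<rbrakk> \<Longrightarrow> x \<sqinter> \<sim> x \<sqsubseteq> y \<squnion> \<sim> y"

locale kan_algebra = kleene_algebra +
  assumes neg_closed: "x \<in> carrier T \<Longrightarrow> \<^bold>\<not> x \<in> carrier T"
    and N1: "\<lbrakk>x \<in> carrier T; y \<in> carrier T\<rbrakk>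
      \<Longrightarrow> \<^bold>\<not> (x \<sqinter> \<^bold>\<not> (x \<sqinter> y)) = \<^bold>\<not> (x \<sqinter> \<^bold>\<not> y)"
    and N2: "\<lbrakk>x \<in> carrier T; y \<in> carrier T\<rbrakk> \<Longrightarrow> \<^bold>\<not> (x \<squnion> y) = \<^bold>\<not> x \<sqinter> \<^bold>\<not> y"
    and N3: "x \<in> carrier T \<Longrightarrow> x \<sqinter> \<sim> x = x \<sqinter> \<^bold>\<not> x"
    and N4: "x \<in> carrier T \<Longrightarrow> \<sim> x \<sqsubseteq> \<^bold>\<not> x"
    and N5: "\<lbrakk>x \<in> carrier T; y \<in> carrier T\<rbrakk>
      \<Longrightarrow> \<^bold>\<not> (x \<sqinter> y) = \<^bold>\<not> ((\<sim> \<^bold>\<not> x) \<sqinter> y)"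

locale centered_kan_algebra = kan_algebra +
  assumes center_closed: "center T \<in> carrier T"
    and tilde_center: "\<sim> (center T) = center T"

locale stone_kan_algebra = kan_algebra +
  assumes stone: "x \<in> carrier T \<Longrightarrow> \<^bold>\<not> x \<squnion> \<^bold>\<not> \<^bold>\<not> x = \<one>"

locale centered_stone_kan_algebra =
  centered_kan_algebra T + stone_kan_algebra T for T (structure)

definition lozenge :: "('a, 'm) kan_struct_scheme \<Rightarrow> 'a \<Rightarrow> 'a" ("\<diamond>\<index> _" [80] 80) where
  "\<diamond>\<^bsub>T\<^esub> x = \<sim>\<^bsub>T\<^esub> \<^bold>\<not>\<^bsub>T\<^esub> x"

definition square :: "('a, 'm) kan_struct_scheme \<Rightarrow> 'a \<Rightarrow> 'a" ("\<box>\<index> _" [80] 80) where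
  "\<box>\<^bsub>T\<^esub> x = \<^bold>\<not>\<^bsub>T\<^esub> \<sim>\<^bsub>T\<^esub> x"

definition lozenge_fixed :: "('a, 'm) kan_struct_scheme \<Rightarrow> 'a set" where
  "lozenge_fixed T = {x \<in> carrier T. \<diamond>\<^bsub>T\<^esub> x = x}"

definition square_fixed :: "('a, 'm) kan_struct_scheme \<Rightarrow> 'a set" where
  "square_fixed T = {x \<in> carrier T. \<box>\<^bsub>T\<^esub> x = x}"

definition M :: "('a, 'm) kan_struct_scheme \<Rightarrow> ('a \<times> 'a) centered_kan_struct" where
  "M T = \<lparr>
     carrier = {(x, y). x \<in> lozenge_fixed T \<and> y \<in> square_fixed T \<and> x \<sqsubseteq>\<^bsub>T\<^esub> y},
     join = (\<lambda>(a, b) (d, e). (a \<squnion>\<^bsub>T\<^esub> d, \<box>\<^bsub>T\<^esub> (b \<squnion>\<^bsub>T\<^esub> e))),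
     meet = (\<lambda>(a, b) (d, e). (\<diamond>\<^bsub>T\<^esub> (a \<sqinter>\<^bsub>T\<^esub> d), b \<sqinter>\<^bsub>T\<^esub> e)),
     tilde = (\<lambda>(a, b). (\<sim>\<^bsub>T\<^esub> b, \<sim>\<^bsub>T\<^esub> a)),
     neg = (\<lambda>(a, b). (\<diamond>\<^bsub>T\<^esub> \<^bold>\<not>\<^bsub>T\<^esub> a, \<sim>\<^bsub>T\<^esub> a)),
     zero = (\<zero>\<^bsub>T\<^esub>, \<zero>\<^bsub>T\<^esub>),
     one = (\<one>\<^bsub>T\<^esub>, \<one>\<^bsub>T\<^esub>),
     center = (\<zero>\<^bsub>T\<^esub>, \<one>\<^bsub>T\<^esub>)\<rparr>"

end

theory Submission
  imports Defs
begin

text \<open>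
  In a KAN-algebra the operator \<open>\<diamond>\<close> is an interior operator that behaves like a lattice
  homomorphism: it satisfies \<open>\<diamond> (x \<squnion> y) = \<diamond> x \<squnion> \<diamond> y\<close> and, by (N5),
  \<open>\<diamond> (\<diamond> x \<sqinter> y) = \<diamond> (x \<sqinter> y)\<close>. Hence the \<open>\<diamond>\<close>-fixed elements, with join \<open>x \<squnion> y\<close> and meet
  \<open>\<diamond> (x \<sqinter> y)\<close>, are a homomorphic image of the lattice reduct and form a bounded distributive
  lattice. Equation (N1) makes \<open>\<diamond> \<^bold>\<not> a\<close> the pseudocomplement of \<open>a\<close> in that lattice; the two
  properties that matter here are \<open>\<diamond> (a \<sqinter> \<^bold>\<not> a) = \<zero>\<close> and
  \<open>\<diamond> (a \<sqinter> \<^bold>\<not> (a \<sqinter> d)) = \<diamond> (a \<sqinter> \<^bold>\<not> d)\<close>.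

  The De Morgan involution exchanges \<open>\<diamond>\<close> with \<open>\<box>\<close>, so the \<open>\<box>\<close>-fixed elements form the dual
  lattice. Replacing the second coordinate of a pair \<open>(a, b)\<close> by \<open>\<sim> b\<close> turns the condition
  \<open>a \<sqsubseteq> b\<close> into disjointness of \<open>a\<close> and \<open>\<sim> b\<close>, and exhibits \<open>M T\<close> as Kalman's construction on
  the pseudocomplemented lattice of \<open>\<diamond>\<close>-fixed elements: pairs of disjoint elements, the
  involution swapping coordinates, and center the pair of two zeros. Lattice identities
  therefore hold coordinatewise (lemma \<open>M_bounded_distributive_lattice\<close>). In lemma \<open>M_kan_algebra\<close>,
  (N1) and (N3) reduce to the two properties of the pseudocomplement, (N4) to disjointness of
  \<open>a\<close> and \<open>\<sim> b\<close>, and (N5) is immediate, because the negation of a pair depends on its first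
  coordinate only. Finally, applying \<open>\<diamond>\<close> to the Stone equation of \<open>T\<close> gives the Stone
  equation in the first coordinate, while in the second coordinate that equation says that \<open>a\<close>
  is disjoint from its pseudocomplement.
\<close>

section \<open>Order and De Morgan laws\<close>

context bounded_distributive_lattice
begin

lemmas ops_closed [simp] = join_closed meet_closed zero_closed one_closed

lemma meet_idem: "x \<in> carrier T \<Longrightarrow> x \<sqinter> x = x"
  by (metis join_absorb meet_absorb meet_closed)

lemma meet_left_comm:
  "\<lbrakk>x \<in> carrier T; y \<in> carrier T; z \<in> carrier T\<rbrakk> \<Longrightarrow> x \<sqinter> (y \<sqinter> z) = y \<sqinter> (x \<sqinter> z)"
  by (metis meet_assoc meet_comm)

lemma le_iff_join:
  "\<lbrakk>x \<in> carrier T; y \<in> carrier T\<rbrakk> \<Longrightarrow> x \<sqsubseteq> y \<longleftrightarrow> x \<squnion> y = y"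
  unfolding le_def by (metis join_absorb meet_absorb join_comm meet_comm)

lemma le_refl: "x \<in> carrier T \<Longrightarrow> x \<sqsubseteq> x"
  by (simp add: le_def meet_idem)

lemma le_trans:
  "\<lbrakk>x \<sqsubseteq> y; y \<sqsubseteq> z; x \<in> carrier T; y \<in> carrier T; z \<in> carrier T\<rbrakk> \<Longrightarrow> x \<sqsubseteq> z"
  unfolding le_def by (metis meet_assoc)

lemma le_antisym:
  "\<lbrakk>x \<sqsubseteq> y; y \<sqsubseteq> x; x \<in> carrier T; y \<in> carrier T\<rbrakk> \<Longrightarrow> x = y"
  unfolding le_def by (metis meet_comm)

lemma meet_le1: "\<lbrakk>x \<in> carrier T; y \<in> carrier T\<rbrakk> \<Longrightarrow> x \<sqinter> y \<sqsubseteq> x"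
  unfolding le_def by (metis meet_assoc meet_comm meet_idem)

lemma meet_mono:
  "\<lbrakk>x \<sqsubseteq> y; u \<sqsubseteq> v; x \<in> carrier T; y \<in> carrier T; u \<in> carrier T; v \<in> carrier T\<rbrakk>
    \<Longrightarrow> x \<sqinter> u \<sqsubseteq> y \<sqinter> v"
  unfolding le_def by (metis meet_assoc meet_left_comm meet_closed)

lemma join_mono:
  assumes "x \<sqsubseteq> y" "u \<sqsubseteq> v"
    and "x \<in> carrier T" "y \<in> carrier T" "u \<in> carrier T" "v \<in> carrier T"
  shows "x \<squnion> u \<sqsubseteq> y \<squnion> v"
proof -
  have "x \<squnion> y = y" "u \<squnion> v = v"
    using assms by (simp_all add: le_iff_join[symmetric])
  then have "(x \<squnion> u) \<squnion> (y \<squnion> v) = y \<squnion> v"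
    using assms(3-) by (metis join_assoc join_comm join_closed)
  then show ?thesis
    using assms by (simp add: le_iff_join)
qed

lemma zero_meet: "x \<in> carrier T \<Longrightarrow> \<zero> \<sqinter> x = \<zero>"
  using zero_least le_def by metis

lemma meet_one: "x \<in> carrier T \<Longrightarrow> x \<sqinter> \<one> = x"
  using one_greatest le_def by metis

lemma le_zero: "\<lbrakk>x \<sqsubseteq> \<zero>; x \<in> carrier T\<rbrakk> \<Longrightarrow> x = \<zero>"
  using le_antisym zero_least by simp

lemma one_le: "\<lbrakk>\<one> \<sqsubseteq> x; x \<in> carrier T\<rbrakk> \<Longrightarrow> x = \<one>"
  using le_antisym one_greatest by simp

end

context kleene_algebra
begin

lemmas tilde_simps [simp] = tilde_closed tilde_tilde

lemma tilde_meet: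
  "\<lbrakk>x \<in> carrier T; y \<in> carrier T\<rbrakk> \<Longrightarrow> \<sim> (x \<sqinter> y) = \<sim> x \<squnion> \<sim> y"
  by (metis tilde_join tilde_tilde tilde_closed join_closed)

lemma tilde_antimono:
  "\<lbrakk>x \<sqsubseteq> y; x \<in> carrier T; y \<in> carrier T\<rbrakk> \<Longrightarrow> \<sim> y \<sqsubseteq> \<sim> x"
  by (metis le_def le_iff_join tilde_closed tilde_meet join_comm)

lemma tilde_one: "\<sim> \<one> = \<zero>"
  by (metis tilde_antimono tilde_tilde tilde_closed one_greatest le_zero zero_closed one_closed)

lemma tilde_zero: "\<sim> \<zero> = \<one>"
  by (metis tilde_one tilde_tilde one_closed)

end

section \<open>The operators \<open>\<diamond>\<close> and \<open>\<box>\<close>\<close>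

context kan_algebra
begin

declare neg_closed [simp]

lemma lozenge_closed [simp]: "x \<in> carrier T \<Longrightarrow> \<diamond> x \<in> carrier T"
  by (simp add: lozenge_def)

lemma square_closed [simp]: "x \<in> carrier T \<Longrightarrow> \<box> x \<in> carrier T"
  by (simp add: square_def)

text \<open>This duality transfers every fact on \<open>\<diamond>\<close> to one on \<open>\<box>\<close>.\<close>

lemma tilde_lozenge: "x \<in> carrier T \<Longrightarrow> \<sim> (\<diamond> x) = \<box> (\<sim> x)"
  by (simp add: lozenge_def square_def)

lemma tilde_square: "x \<in> carrier T \<Longrightarrow> \<sim> (\<box> x) = \<diamond> (\<sim> x)"
  by (simp add: lozenge_def square_def)

lemma square_eq: "x \<in> carrier T \<Longrightarrow> \<box> x = \<sim> (\<diamond> (\<sim> x))"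
  by (simp add: lozenge_def square_def)

lemma neg_one: "\<^bold>\<not> \<one> = \<zero>"
  using N3[OF one_closed] by (metis tilde_one meet_comm meet_one one_closed zero_closed neg_closed)

lemma neg_zero: "\<^bold>\<not> \<zero> = \<one>"
  using N4[OF zero_closed] by (simp add: tilde_zero one_le)

lemma lozenge_zero: "\<diamond> \<zero> = \<zero>"
  by (simp add: lozenge_def neg_zero tilde_one)

lemma lozenge_one: "\<diamond> \<one> = \<one>"
  by (simp add: lozenge_def neg_one tilde_zero)

lemma square_zero: "\<box> \<zero> = \<zero>"
  by (simp add: square_def tilde_zero neg_one)

lemma square_one: "\<box> \<one> = \<one>"
  by (simp add: square_def tilde_one neg_zero)

lemma lozenge_le: "x \<in> carrier T \<Longrightarrow> \<diamond> x \<sqsubseteq> x"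
  using tilde_antimono[OF N4, of x] by (simp add: lozenge_def)

lemma le_square: "x \<in> carrier T \<Longrightarrow> x \<sqsubseteq> \<box> x"
  using N4[of "\<sim> x"] by (simp add: square_def)

text \<open>The instance \<open>y = \<one>\<close> of (N5).\<close>

lemma neg_lozenge: "x \<in> carrier T \<Longrightarrow> \<^bold>\<not> (\<diamond> x) = \<^bold>\<not> x"
  using N5[of x \<one>] by (simp add: meet_one lozenge_def)

lemma lozenge_idem: "x \<in> carrier T \<Longrightarrow> \<diamond> (\<diamond> x) = \<diamond> x"
  by (metis lozenge_def neg_lozenge)

lemma square_idem: "x \<in> carrier T \<Longrightarrow> \<box> (\<box> x) = \<box> x"
  by (simp add: square_eq lozenge_idem)

lemma lozenge_join:
  "\<lbrakk>x \<in> carrier T; y \<in> carrier T\<rbrakk> \<Longrightarrow> \<diamond> (x \<squnion> y) = \<diamond> x \<squnion> \<diamond> y"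
  by (simp add: lozenge_def N2 tilde_meet)

lemma square_meet:
  "\<lbrakk>x \<in> carrier T; y \<in> carrier T\<rbrakk> \<Longrightarrow> \<box> (x \<sqinter> y) = \<box> x \<sqinter> \<box> y"
  by (simp add: square_def N2 tilde_meet)

lemma lozenge_mono:
  "\<lbrakk>x \<sqsubseteq> y; x \<in> carrier T; y \<in> carrier T\<rbrakk> \<Longrightarrow> \<diamond> x \<sqsubseteq> \<diamond> y"
  by (metis le_iff_join lozenge_join lozenge_closed)

lemma lozenge_lozenge_meet:
  "\<lbrakk>x \<in> carrier T; y \<in> carrier T\<rbrakk> \<Longrightarrow> \<diamond> (\<diamond> x \<sqinter> y) = \<diamond> (x \<sqinter> y)"
  by (metis N5 lozenge_def)

lemma lozenge_meet_lozenge: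
  "\<lbrakk>x \<in> carrier T; y \<in> carrier T\<rbrakk> \<Longrightarrow> \<diamond> (x \<sqinter> \<diamond> y) = \<diamond> (x \<sqinter> y)"
  by (metis lozenge_lozenge_meet meet_comm lozenge_closed)

lemma square_square_join:
  "\<lbrakk>x \<in> carrier T; y \<in> carrier T\<rbrakk> \<Longrightarrow> \<box> (\<box> x \<squnion> y) = \<box> (x \<squnion> y)"
  by (simp add: square_eq tilde_join lozenge_lozenge_meet)

lemma square_join_square:
  "\<lbrakk>x \<in> carrier T; y \<in> carrier T\<rbrakk> \<Longrightarrow> \<box> (x \<squnion> \<box> y) = \<box> (x \<squnion> y)"
  by (metis square_square_join join_comm square_closed)

text \<open>
  (N1) is an equation between negations, and \<open>\<diamond>\<close> factors through the negation. The two
  consequences below say that \<open>\<diamond> \<^bold>\<not> x\<close> is disjoint from \<open>x\<close>, and that it is the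
  pseudocomplement, among the \<open>\<diamond>\<close>-fixed elements.
\<close>

lemma lozenge_meet_neg: "x \<in> carrier T \<Longrightarrow> \<diamond> (x \<sqinter> \<^bold>\<not> x) = \<zero>"
  using N1[of x \<one>]
  by (metis lozenge_def lozenge_zero meet_one neg_one meet_comm zero_meet one_closed zero_closed)

lemma lozenge_meet_neg_meet:
  "\<lbrakk>x \<in> carrier T; y \<in> carrier T\<rbrakk> \<Longrightarrow> \<diamond> (x \<sqinter> \<^bold>\<not> (x \<sqinter> y)) = \<diamond> (x \<sqinter> \<^bold>\<not> y)"
  by (simp add: lozenge_def N1)

text \<open>(N3) replaces the negation by the involution.\<close>

lemma lozenge_meet_tilde: "x \<in> carrier T \<Longrightarrow> \<diamond> (x \<sqinter> \<sim> x) = \<zero>"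
  by (simp add: N3 lozenge_meet_neg)

lemma lozenge_meet_tilde_eq_zero:
  assumes "x \<sqsubseteq> y" "x \<in> carrier T" "y \<in> carrier T"
  shows "\<diamond> (x \<sqinter> \<sim> y) = \<zero>"
proof -
  have "\<diamond> (x \<sqinter> \<sim> y) \<sqsubseteq> \<diamond> (y \<sqinter> \<sim> y)"
    using assms by (intro lozenge_mono meet_mono le_refl) simp_all
  then show ?thesis
    using assms by (simp add: lozenge_meet_tilde le_zero)
qed

section \<open>The lattice of pairs\<close>

lemma M_simps [simp]:
  "(a, b) \<squnion>\<^bsub>M T\<^esub> (d, e) = (a \<squnion> d, \<box> (b \<squnion> e))"
  "(a, b) \<sqinter>\<^bsub>M T\<^esub> (d, e) = (\<diamond> (a \<sqinter> d), b \<sqinter> e)"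
  "\<sim>\<^bsub>M T\<^esub> (a, b) = (\<sim> b, \<sim> a)"
  "\<^bold>\<not>\<^bsub>M T\<^esub> (a, b) = (\<diamond> (\<^bold>\<not> a), \<sim> a)"
  "\<zero>\<^bsub>M T\<^esub> = (\<zero>, \<zero>)"
  "\<one>\<^bsub>M T\<^esub> = (\<one>, \<one>)"
  "center (M T) = (\<zero>, \<one>)"
  by (simp_all add: M_def)

lemma mem_M:
  "(a, b) \<in> carrier (M T) \<longleftrightarrow>
    a \<in> carrier T \<and> b \<in> carrier T \<and> \<diamond> a = a \<and> \<box> b = b \<and> a \<sqsubseteq> b"
  by (auto simp: M_def lozenge_fixed_def square_fixed_def)

text \<open>The meet of \<open>M T\<close> applies \<open>\<diamond>\<close> in the first coordinate; since \<open>\<diamond>\<close> decreases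
  elements, the resulting order is still the coordinatewise one.\<close>

lemma le_M:
  assumes "(a, b) \<in> carrier (M T)" "(d, e) \<in> carrier (M T)"
  shows "(a, b) \<sqsubseteq>\<^bsub>M T\<^esub> (d, e) \<longleftrightarrow> a \<sqsubseteq> d \<and> b \<sqsubseteq> e"
proof -
  have "\<diamond> (a \<sqinter> d) = a \<longleftrightarrow> a \<sqinter> d = a"
    using assms by (metis mem_M lozenge_le meet_le1 meet_closed le_antisym)
  then show ?thesis
    by (simp add: le_def)
qed

lemma M_join_closed:
  assumes "(a, b) \<in> carrier (M T)" "(d, e) \<in> carrier (M T)"
  shows "(a, b) \<squnion>\<^bsub>M T\<^esub> (d, e) \<in> carrier (M T)"
proof -
  have "a \<squnion> d \<sqsubseteq> \<box> (b \<squnion> e)"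
    using assms le_trans[OF join_mono le_square] by (simp add: mem_M)
  then show ?thesis
    using assms by (simp add: mem_M lozenge_join square_idem)
qed

lemma M_meet_closed:
  assumes "(a, b) \<in> carrier (M T)" "(d, e) \<in> carrier (M T)"
  shows "(a, b) \<sqinter>\<^bsub>M T\<^esub> (d, e) \<in> carrier (M T)"
proof -
  have "\<diamond> (a \<sqinter> d) \<sqsubseteq> b \<sqinter> e"
    using assms le_trans[OF lozenge_le meet_mono] by (simp add: mem_M)
  then show ?thesis
    using assms by (simp add: mem_M square_meet lozenge_idem)
qed

lemma M_tilde_closed:
  "(a, b) \<in> carrier (M T) \<Longrightarrow> \<sim>\<^bsub>M T\<^esub> (a, b) \<in> carrier (M T)"
  by (simp add: mem_M tilde_antimono tilde_square[symmetric] tilde_lozenge[symmetric])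

lemma M_neg_closed:
  assumes "(a, b) \<in> carrier (M T)"
  shows "\<^bold>\<not>\<^bsub>M T\<^esub> (a, b) \<in> carrier (M T)"
proof -
  have a: "a \<in> carrier T" "\<diamond> a = a"
    using assms by (simp_all add: mem_M)
  \<comment> \<open>A \<open>\<diamond>\<close>-fixed \<open>a\<close> equals \<open>\<sim> \<^bold>\<not> a\<close>, so that (N4) at \<open>\<^bold>\<not> a\<close> gives
    \<open>a \<sqsubseteq> \<^bold>\<not> \<^bold>\<not> a\<close>, which may fail for elements that are not \<open>\<diamond>\<close>-fixed.\<close>
  have "a \<sqsubseteq> \<^bold>\<not> (\<^bold>\<not> a)"
    using a N4[of "\<^bold>\<not> a"] by (simp add: lozenge_def)
  then have "\<diamond> (\<^bold>\<not> a) \<sqsubseteq> \<sim> a"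
    using a tilde_antimono by (simp add: lozenge_def)
  then show ?thesis
    using a by (simp add: mem_M lozenge_idem tilde_lozenge[symmetric])
qed

lemma M_bounded_distributive_lattice: "bounded_distributive_lattice (M T)"
proof
  fix x y assume "x \<in> carrier (M T)" "y \<in> carrier (M T)"
  moreover obtain a b d e where [simp]: "x = (a, b)" "y = (d, e)"
    by fastforce
  ultimately have xy: "(a, b) \<in> carrier (M T)" "(d, e) \<in> carrier (M T)"
    by simp_all
  note c = xy[unfolded mem_M]
  show "x \<squnion>\<^bsub>M T\<^esub> y \<in> carrier (M T)" "x \<sqinter>\<^bsub>M T\<^esub> y \<in> carrier (M T)"
    using M_join_closed[OF xy] M_meet_closed[OF xy] by (simp_all del: M_simps)
  show "x \<squnion>\<^bsub>M T\<^esub> y = y \<squnion>\<^bsub>M T\<^esub> x" "x \<sqinter>\<^bsub>M T\<^esub> y = y \<sqinter>\<^bsub>M T\<^esub> x"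
    using c by (simp_all add: join_comm meet_comm)
  have "a \<squnion> \<diamond> (a \<sqinter> d) = a"
    using c lozenge_join[of a "a \<sqinter> d"] by (simp add: join_absorb)
  then show "x \<squnion>\<^bsub>M T\<^esub> (x \<sqinter>\<^bsub>M T\<^esub> y) = x"
    using c by (simp add: join_absorb)
  have "b \<sqinter> \<box> (b \<squnion> e) = b"
    using c square_meet[of b "b \<squnion> e"] by (simp add: meet_absorb)
  then show "x \<sqinter>\<^bsub>M T\<^esub> (x \<squnion>\<^bsub>M T\<^esub> y) = x"
    using c by (simp add: meet_absorb)
next
  fix x y z assume "x \<in> carrier (M T)" "y \<in> carrier (M T)" "z \<in> carrier (M T)"
  moreover obtain a b d e f g where [simp]: "x = (a, b)" "y = (d, e)" "z = (f, g)"
    by (metis surj_pair)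
  ultimately have c: "a \<in> carrier T" "b \<in> carrier T" "d \<in> carrier T" "e \<in> carrier T"
      "f \<in> carrier T" "g \<in> carrier T" "\<box> b = b"
    by (simp_all add: mem_M)
  show "x \<squnion>\<^bsub>M T\<^esub> y \<squnion>\<^bsub>M T\<^esub> z = x \<squnion>\<^bsub>M T\<^esub> (y \<squnion>\<^bsub>M T\<^esub> z)"
    using c by (simp add: square_square_join square_join_square join_assoc)
  show "x \<sqinter>\<^bsub>M T\<^esub> y \<sqinter>\<^bsub>M T\<^esub> z = x \<sqinter>\<^bsub>M T\<^esub> (y \<sqinter>\<^bsub>M T\<^esub> z)"
    using c by (simp add: lozenge_lozenge_meet lozenge_meet_lozenge meet_assoc)
  have "b \<sqinter> \<box> (e \<squnion> g) = \<box> ((b \<sqinter> e) \<squnion> (b \<sqinter> g))"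
    using c square_meet[of b "e \<squnion> g"] by (simp add: meet_join_distrib)
  then show "x \<sqinter>\<^bsub>M T\<^esub> (y \<squnion>\<^bsub>M T\<^esub> z) = (x \<sqinter>\<^bsub>M T\<^esub> y) \<squnion>\<^bsub>M T\<^esub> (x \<sqinter>\<^bsub>M T\<^esub> z)"
    using c by (simp add: meet_join_distrib lozenge_join)
next
  show "\<zero>\<^bsub>M T\<^esub> \<in> carrier (M T)" "\<one>\<^bsub>M T\<^esub> \<in> carrier (M T)"
    by (simp_all add: mem_M lozenge_zero lozenge_one square_zero square_one le_refl)
next
  fix x assume "x \<in> carrier (M T)"
  then show "\<zero>\<^bsub>M T\<^esub> \<sqsubseteq>\<^bsub>M T\<^esub> x" "x \<sqsubseteq>\<^bsub>M T\<^esub> \<one>\<^bsub>M T\<^esub>"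
    by (cases x; simp add: le_def mem_M zero_meet lozenge_zero meet_one)+
qed

section \<open>Involution, negation and center\<close>

text \<open>The condition \<open>a \<sqsubseteq> b\<close> on pairs enters here: it makes the first coordinate
  vanish, and dually the second coordinate of the join in the next lemma. Together they give the
  Kleene inequality.\<close>

lemma M_meet_tilde:
  "(a, b) \<in> carrier (M T) \<Longrightarrow> (a, b) \<sqinter>\<^bsub>M T\<^esub> \<sim>\<^bsub>M T\<^esub> (a, b) = (\<zero>, b \<sqinter> \<sim> a)"
  by (simp add: mem_M lozenge_meet_tilde_eq_zero)

lemma M_join_tilde:
  assumes "(a, b) \<in> carrier (M T)"
  shows "(a, b) \<squnion>\<^bsub>M T\<^esub> \<sim>\<^bsub>M T\<^esub> (a, b) = (a \<squnion> \<sim> b, \<one>)"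
proof -
  have c: "a \<in> carrier T" "b \<in> carrier T" "a \<sqsubseteq> b"
    using assms by (simp_all add: mem_M)
  have "\<box> (b \<squnion> \<sim> a) = \<sim> (\<diamond> (a \<sqinter> \<sim> b))"
    using c by (simp add: square_eq tilde_join meet_comm)
  then show ?thesis
    using c by (simp add: lozenge_meet_tilde_eq_zero tilde_zero)
qed

lemma M_kleene_algebra: "kleene_algebra (M T)"
proof -
  interpret M: bounded_distributive_lattice "M T"
    by (rule M_bounded_distributive_lattice)
  show ?thesis
  proof
    fix x assume "x \<in> carrier (M T)"
    then show "\<sim>\<^bsub>M T\<^esub> x \<in> carrier (M T)"
      by (cases x) (simp only: M_tilde_closed)
  next
    fix x assume "x \<in> carrier (M T)"
    then show "\<sim>\<^bsub>M T\<^esub> \<sim>\<^bsub>M T\<^esub> x = x"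
      by (cases x) (simp add: mem_M)
  next
    fix x y assume "x \<in> carrier (M T)" "y \<in> carrier (M T)"
    then show "\<sim>\<^bsub>M T\<^esub> (x \<squnion>\<^bsub>M T\<^esub> y) = \<sim>\<^bsub>M T\<^esub> x \<sqinter>\<^bsub>M T\<^esub> \<sim>\<^bsub>M T\<^esub> y"
      by (cases x; cases y) (simp add: mem_M tilde_join tilde_square)
  next
    fix x y assume "x \<in> carrier (M T)" "y \<in> carrier (M T)"
    moreover obtain a b d e where [simp]: "x = (a, b)" "y = (d, e)"
      by fastforce
    ultimately have xy: "(a, b) \<in> carrier (M T)" "(d, e) \<in> carrier (M T)"
      by simp_all
    have "(\<zero>, b \<sqinter> \<sim> a) \<sqsubseteq>\<^bsub>M T\<^esub> (d \<squnion> \<sim> e, \<one>)"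
      using xy by (simp add: mem_M le_def zero_meet lozenge_zero meet_one)
    then show "x \<sqinter>\<^bsub>M T\<^esub> \<sim>\<^bsub>M T\<^esub> x \<sqsubseteq>\<^bsub>M T\<^esub> y \<squnion>\<^bsub>M T\<^esub> \<sim>\<^bsub>M T\<^esub> y"
      using M_meet_tilde[OF xy(1)] M_join_tilde[OF xy(2)] by (simp del: M_simps)
  qed
qed

lemma M_kan_algebra: "kan_algebra (M T)"
proof -
  interpret M: kleene_algebra "M T"
    by (rule M_kleene_algebra)
  show ?thesis
  proof
    fix x assume "x \<in> carrier (M T)"
    moreover obtain a b where [simp]: "x = (a, b)"
      by fastforce
    ultimately have x: "(a, b) \<in> carrier (M T)"
      by simp
    note c = x[unfolded mem_M]
    show "\<^bold>\<not>\<^bsub>M T\<^esub> x \<in> carrier (M T)"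
      using M_neg_closed[OF x] by (simp del: M_simps)
    show "x \<sqinter>\<^bsub>M T\<^esub> \<sim>\<^bsub>M T\<^esub> x = x \<sqinter>\<^bsub>M T\<^esub> \<^bold>\<not>\<^bsub>M T\<^esub> x"
      using c by (simp add: lozenge_meet_tilde_eq_zero lozenge_meet_lozenge lozenge_meet_neg)
    have "\<sim> b \<sqsubseteq> \<^bold>\<not> a"
      using c le_trans[OF tilde_antimono N4] by simp
    then have "\<diamond> (\<sim> b) \<sqsubseteq> \<diamond> (\<^bold>\<not> a)"
      using c lozenge_mono by simp
    then have "\<sim> b \<sqsubseteq> \<diamond> (\<^bold>\<not> a)"
      using c by (simp add: tilde_square[symmetric])
    then show "\<sim>\<^bsub>M T\<^esub> x \<sqsubseteq>\<^bsub>M T\<^esub> \<^bold>\<not>\<^bsub>M T\<^esub> x"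
      using le_M[of "\<sim> b" "\<sim> a" "\<diamond> (\<^bold>\<not> a)" "\<sim> a"] M_tilde_closed[OF x] M_neg_closed[OF x] c
      by (simp add: le_refl)
  next
    fix x y assume xy: "x \<in> carrier (M T)" "y \<in> carrier (M T)"
    show "\<^bold>\<not>\<^bsub>M T\<^esub> (x \<sqinter>\<^bsub>M T\<^esub> \<^bold>\<not>\<^bsub>M T\<^esub> (x \<sqinter>\<^bsub>M T\<^esub> y)) = \<^bold>\<not>\<^bsub>M T\<^esub> (x \<sqinter>\<^bsub>M T\<^esub> \<^bold>\<not>\<^bsub>M T\<^esub> y)"
      using xy by (cases x; cases y)
        (simp add: mem_M lozenge_meet_lozenge neg_lozenge lozenge_meet_neg_meet)
    show "\<^bold>\<not>\<^bsub>M T\<^esub> (x \<squnion>\<^bsub>M T\<^esub> y) = \<^bold>\<not>\<^bsub>M T\<^esub> x \<sqinter>\<^bsub>M T\<^esub> \<^bold>\<not>\<^bsub>M T\<^esub> y"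
      using xy by (cases x; cases y)
        (simp add: mem_M N2 tilde_join lozenge_meet_lozenge lozenge_lozenge_meet)
    show "\<^bold>\<not>\<^bsub>M T\<^esub> (x \<sqinter>\<^bsub>M T\<^esub> y) = \<^bold>\<not>\<^bsub>M T\<^esub> ((\<sim>\<^bsub>M T\<^esub> \<^bold>\<not>\<^bsub>M T\<^esub> x) \<sqinter>\<^bsub>M T\<^esub> y)"
      using xy by (cases x; cases y) (simp add: mem_M)
  qed
qed

lemma M_centered_kan_algebra: "centered_kan_algebra (M T)"
proof -
  interpret M: kan_algebra "M T"
    by (rule M_kan_algebra)
  show ?thesis
    by standard
      (simp_all add: mem_M lozenge_zero square_one zero_least tilde_zero tilde_one)
qed

end

section \<open>The Stone equation\<close>

context stone_kan_algebra
begin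

lemma M_stone_kan_algebra: "stone_kan_algebra (M T)"
proof -
  interpret M: kan_algebra "M T"
    by (rule M_kan_algebra)
  show ?thesis
  proof
    fix x assume "x \<in> carrier (M T)"
    moreover obtain a b where [simp]: "x = (a, b)"
      by fastforce
    ultimately have a: "a \<in> carrier T"
      by (simp add: mem_M)
    have "\<diamond> (\<^bold>\<not> a) \<squnion> \<diamond> (\<^bold>\<not> (\<^bold>\<not> a)) = \<one>"
      using a by (simp add: lozenge_join[symmetric] stone lozenge_one)
    moreover have "\<box> (\<sim> a \<squnion> \<sim> (\<diamond> (\<^bold>\<not> a))) = \<sim> (\<diamond> (a \<sqinter> \<diamond> (\<^bold>\<not> a)))"
      using a by (simp add: square_eq tilde_join)
    ultimately show "\<^bold>\<not>\<^bsub>M T\<^esub> x \<squnion>\<^bsub>M T\<^esub> \<^bold>\<not>\<^bsub>M T\<^esub> \<^bold>\<not>\<^bsub>M T\<^esub> x = \<one>\<^bsub>M T\<^esub>"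
      using a by (simp add: neg_lozenge lozenge_meet_lozenge lozenge_meet_neg tilde_zero)
  qed
qed

end

theorem corollary4p1p1:
  fixes T :: "('a, 'm) kan_struct_scheme"
  assumes "stone_kan_algebra T"
  shows "centered_stone_kan_algebra (M T)"
proof -
  interpret stone_kan_algebra T
    by (rule assms)
  show ?thesis
    by (intro centered_stone_kan_algebra.intro M_centered_kan_algebra M_stone_kan_algebra)
qed

end
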